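(* Let $R$ be a field, let $I$ be an involutive division on the monomials of $R\langle x_1,\dots,x_n\rangle$ that is strong and continuous, and let $O$ be an admissible monomial ordering. If a finite set $P\subset R\langle x_1,\dots,x_n\rangle$ of nonzero polynomials is a Locally Involutive Basis with respect to $I$ and $O$, then $P$ is an Involutive Basis with respect to $I$ and $O$.
   Context: Monomials are words in the noncommuting variables $x_1,\dots,x_n$; a monomial ordering (total order on monomials) is admissible if $1<m$ for all $m\neq 1$ and $m_1<m_2$ implies $\ell m_1 r<\ell m_2 r$ for all monomials $\ell,r$. $\mathrm{LM},\mathrm{LT},\mathrm{LC}$ denote leading monomial, term, coefficient. Involutive division. A rule $I$ assigning to every finite set $U$ of monomials and every $u\in U$ a set $\mathcal M^L_I(u,U)\subseteq\{x_1,\dots,x_n\}$ of left multiplicative variables and a set $\mathcal M^R_I(u,U)\subseteq\{x_1,\dots,x_n\}$ of right multiplicative variables (other variables are left, resp. right, nonmultiplicative). For $u\in U$ and a factorisation $w=v_1uv_2$, $u$ is an involutive divisor of $w$ at this factorisation if (thin divisors) the last letter of $v_1$ (if $v_1\ne1$) is in $\mathcal M^L_I(u,U)$ and the first letter of $v_2$ (if $v_2\neq1$) is in $\mathcal M^R_I(u,U)$. Write $u\mid_I w$ if this holds for some factorisation, and let $\mathcal C_I(u,U)=\{w : u\mid_I w\}$. $I$ is strong if for every finite $U$: (Disjoint Cones) if $\mathcal C_I(u_1,U)\cap\mathcal C_I(u_2,U)\ne\emptyset$ for $u_1,u_2\in U$, then one of these cones is contained in the other; (Unique Divisor) each $w\in\mathcal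 C_I(u,U)$ is involutively divisible by $u$ at exactly one factorisation; (Subset) if $V\subset U$ then $\mathcal M^L_I(v,U)\subseteq\mathcal M^L_I(v,V)$ and $\mathcal M^R_I(v,U)\subseteq\mathcal M^R_I(v,V)$ for all $v\in V$. Otherwise $I$ is weak. For a finite set $P$ of nonzero polynomials, multiplicative variables of $p\in P$ are those of $\mathrm{LM}(p)$ with respect to $U=\mathrm{LM}(P)$. Involutive reduction of $f$ by $P$: repeatedly take the leading term $c\,w$ of the current polynomial; if some $\mathrm{LM}(p)$, $p\in P$, involutively divides $w$ at $w=v_1\mathrm{LM}(p)v_2$, subtract $c\,\mathrm{LC}(p)^{-1}v_1pv_2$; otherwise move $c\,w$ to the remainder. The result is the involutive remainder $\mathrm{Rem}_I(f,P)$; $f$ involutively reduces to zero using $P$ if it is $0$. $P$ is autoreduced if no $p\in P$ contains a term whose monomial is involutively divisible (multiplicative variables taken over $P$) by $\mathrm{LM}(p')$ for some $p'\in P\setminus\{p\}$. A left (right) prolongation of $p\in P$ is $x_ip$ with $x_i\notin\mathcal M^L_I(\mathrm{LM}(p),\mathrm{LM}(P))$ (resp. $px_i$ with $x_i\notin\mathcal M^R_I(\mathrm{LM}(p),\mathrm{LM}(P))$). An autoreduced $P$ is a Locally Involutive Basis if all left and right prolongations of its elements involutively reduce to zero using $P$, and an Involutive Basis if $upv$ involutively reduces to zero using $P$ for all $p\in P$ and all terms $u,v$. Continuity. Let $w$ be a monomial, $U$ a finite set of monomials, and $(u_1,\dots,u_k)$ a sequence in $U$ with factorisations $w=\ell_iu_ir_i$.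 Suppose for each $1\le i<k$ exactly one of the following holds: (a) $\ell_i\neq1$, its last letter $x$ is not in $\mathcal M^L_I(u_i,U)$, and $u_{i+1}$ involutively divides $xu_i$; (b) $r_i\ne1$, its first letter $x$ is not in $\mathcal M^R_I(u_i,U)$, and $u_{i+1}$ involutively divides $u_ix$; where the occurrence of $u_{i+1}$ in $w$ given by $(\ell_{i+1},r_{i+1})$ is the one induced by its occurrence (as involutive divisor) in the prolongation $xu_i$, resp. $u_ix$, located in $w$. $I$ is continuous if for all such data the pairs $(\ell_i,r_i)$ are pairwise distinct. *)

theory Defs
  imports "HOL-Library.Poly_Mapping"
begin

text \<open>
  Monomials are words, i.e. lists over a finite type \<open>'x\<close> of letters. Making words an additive
  monoid under concatenation turns \<open>'x list \<Rightarrow>\<^sub>0 'k\<close> with the product of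
  \<open>Poly_Mapping\<close> into the free associative algebra on \<open>'x\<close> over \<open>'k\<close>.
\<close>

instantiation list :: (type) monoid_add
begin

definition zero_list :: "'a list" where "zero_list = []"

definition plus_list :: "'a list \<Rightarrow> 'a list \<Rightarrow> 'a list" where "plus_list = (@)"

instance by standard (simp_all add: zero_list_def plus_list_def)

end

type_synonym ('x, 'k) ncpoly = "'x list \<Rightarrow>\<^sub>0 'k"

definition var :: "'x \<Rightarrow> ('x, 'k::zero_neq_one) ncpoly" where
  "var x = Poly_Mapping.single [x] 1"

definition is_term :: "('x, 'k::zero) ncpoly \<Rightarrow> bool" where
  "is_term t \<longleftrightarrow> (\<exists>m c. c \<noteq> 0 \<and> t = Poly_Mapping.single m c)"

type_synonym 'x mon_order = "'x list \<Rightarrow> 'x list \<Rightarrow> bool"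

text \<open>Orderings are given by their strict part.\<close>

definition admissible :: "'x mon_order \<Rightarrow> bool" where
  "admissible lt \<longleftrightarrow>
     irreflp lt \<and> transp lt \<and> totalp lt \<and>
     (\<forall>m. m \<noteq> [] \<longrightarrow> lt [] m) \<and>
     (\<forall>m1 m2 l r. lt m1 m2 \<longrightarrow> lt (l @ m1 @ r) (l @ m2 @ r))"

text \<open>\<open>LM\<close> is meaningful only for nonzero polynomials.\<close>

definition LM :: "'x mon_order \<Rightarrow> ('x, 'k::zero) ncpoly \<Rightarrow> 'x list" where
  "LM lt f = (THE m. m \<in> Poly_Mapping.keys f \<and>
                     (\<forall>m' \<in> Poly_Mapping.keys f. m' \<noteq> m \<longrightarrow> lt m' m))"

definition LC :: "'x mon_order \<Rightarrow> ('x, 'k::zero) ncpoly \<Rightarrow> 'k" where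
  "LC lt f = Poly_Mapping.lookup f (LM lt f)"

definition LT :: "'x mon_order \<Rightarrow> ('x, 'k::zero) ncpoly \<Rightarrow> ('x, 'k) ncpoly" where
  "LT lt f = Poly_Mapping.single (LM lt f) (LC lt f)"

text \<open>
  \<open>left_mult I U u\<close> and \<open>right_mult I U u\<close> are the left and right multiplicative variables of
  \<open>u\<close> over \<open>U\<close>; their values matter only for finite \<open>U\<close> and \<open>u \<in> U\<close>.
\<close>

record 'x involutive_division =
  left_mult :: "'x list set \<Rightarrow> 'x list \<Rightarrow> 'x set"
  right_mult :: "'x list set \<Rightarrow> 'x list \<Rightarrow> 'x set"

text \<open>\<open>u\<close> is an involutive divisor (over \<open>U\<close>) of \<open>w\<close> at the factorisation \<open>w = v1 u v2\<close>.\<close>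

definition inv_div_at ::
  "'x involutive_division \<Rightarrow> 'x list set \<Rightarrow> 'x list \<Rightarrow> 'x list \<Rightarrow> 'x list \<Rightarrow> 'x list \<Rightarrow> bool" where
  "inv_div_at I U u v1 v2 w \<longleftrightarrow>
     w = v1 @ u @ v2 \<and>
     (v1 \<noteq> [] \<longrightarrow> last v1 \<in> left_mult I U u) \<and>
     (v2 \<noteq> [] \<longrightarrow> hd v2 \<in> right_mult I U u)"

definition inv_divides ::
  "'x involutive_division \<Rightarrow> 'x list set \<Rightarrow> 'x list \<Rightarrow> 'x list \<Rightarrow> bool" where
  "inv_divides I U u w \<longleftrightarrow> (\<exists>v1 v2. inv_div_at I U u v1 v2 w)"

definition cone :: "'x involutive_division \<Rightarrow> 'x list set \<Rightarrow> 'x list \<Rightarrow> 'x list set" where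
  "cone I U u = {w. inv_divides I U u w}"

definition strong :: "'x involutive_division \<Rightarrow> bool" where
  "strong I \<longleftrightarrow> (\<forall>U. finite U \<longrightarrow>
     (\<forall>u1\<in>U. \<forall>u2\<in>U. cone I U u1 \<inter> cone I U u2 \<noteq> {} \<longrightarrow>
        cone I U u1 \<subseteq> cone I U u2 \<or> cone I U u2 \<subseteq> cone I U u1) \<and>
     (\<forall>u\<in>U. \<forall>w\<in>cone I U u. \<exists>!(v1, v2). inv_div_at I U u v1 v2 w) \<and>
     (\<forall>V. V \<subseteq> U \<longrightarrow> (\<forall>v\<in>V.
        left_mult I U v \<subseteq> left_mult I V v \<and> right_mult I U v \<subseteq> right_mult I V v)))"

text \<open>
  One step of a chain. Given an occurrence \<open>w = l u r\<close>, the conditions \<open>left_cond\<close> and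
  \<open>right_cond\<close> only say that \<open>u'\<close> involutively divides the nonmultiplicative prolongation of \<open>u\<close>
  by the neighbouring letter; \<open>left_place\<close> and \<open>right_place\<close> say that \<open>w = l' u' r'\<close> is the
  occurrence of \<open>u'\<close> in \<open>w\<close> coming from an involutive divisor occurrence in that prolongation.
\<close>

definition left_cond ::
  "'x involutive_division \<Rightarrow> 'x list set \<Rightarrow> 'x list \<Rightarrow> 'x list \<Rightarrow> 'x list \<Rightarrow> bool" where
  "left_cond I U l u u' \<longleftrightarrow>
     l \<noteq> [] \<and> last l \<notin> left_mult I U u \<and> inv_divides I U u' (last l # u)"

definition right_cond ::
  "'x involutive_division \<Rightarrow> 'x list set \<Rightarrow> 'x list \<Rightarrow> 'x list \<Rightarrow> 'x list \<Rightarrow> bool" where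
  "right_cond I U u r u' \<longleftrightarrow>
     r \<noteq> [] \<and> hd r \<notin> right_mult I U u \<and> inv_divides I U u' (u @ [hd r])"

definition left_place ::
  "'x involutive_division \<Rightarrow> 'x list set \<Rightarrow> 'x list \<Rightarrow> 'x list \<Rightarrow> 'x list \<Rightarrow>
   'x list \<Rightarrow> 'x list \<Rightarrow> 'x list \<Rightarrow> bool" where
  "left_place I U l u r l' u' r' \<longleftrightarrow>
     (\<exists>v1 v2. inv_div_at I U u' v1 v2 (last l # u) \<and> l' = butlast l @ v1 \<and> r' = v2 @ r)"

definition right_place ::
  "'x involutive_division \<Rightarrow> 'x list set \<Rightarrow> 'x list \<Rightarrow> 'x list \<Rightarrow> 'x list \<Rightarrow>
   'x list \<Rightarrow> 'x list \<Rightarrow> 'x list \<Rightarrow> bool" where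
  "right_place I U l u r l' u' r' \<longleftrightarrow>
     (\<exists>v1 v2. inv_div_at I U u' v1 v2 (u @ [hd r]) \<and> l' = l @ v1 \<and> r' = v2 @ tl r)"

definition chain_step ::
  "'x involutive_division \<Rightarrow> 'x list set \<Rightarrow> 'x list \<Rightarrow> 'x list \<Rightarrow> 'x list \<Rightarrow>
   'x list \<Rightarrow> 'x list \<Rightarrow> 'x list \<Rightarrow> bool" where
  "chain_step I U l u r l' u' r' \<longleftrightarrow>
     (left_cond I U l u u' \<and> \<not> right_cond I U u r u' \<and> left_place I U l u r l' u' r') \<or>
     (right_cond I U u r u' \<and> \<not> left_cond I U l u u' \<and> right_place I U l u r l' u' r')"

definition continuous_division :: "'x involutive_division \<Rightarrow> bool" where
  "continuous_division I \<longleftrightarrow>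
     (\<forall>w U k u l r.
        finite U \<longrightarrow>
        (\<forall>i\<in>{1..k::nat}. u i \<in> U \<and> w = l i @ u i @ r i) \<longrightarrow>
        (\<forall>i. 1 \<le> i \<and> i < k \<longrightarrow>
           chain_step I U (l i) (u i) (r i) (l (Suc i)) (u (Suc i)) (r (Suc i))) \<longrightarrow>
        inj_on (\<lambda>i. (l i, r i)) {1..k})"

definition poly_inv_div_at ::
  "'x involutive_division \<Rightarrow> 'x mon_order \<Rightarrow> ('x, 'k::zero) ncpoly set \<Rightarrow>
   ('x, 'k) ncpoly \<Rightarrow> 'x list \<Rightarrow> 'x list \<Rightarrow> 'x list \<Rightarrow> bool" where
  "poly_inv_div_at I lt P p v1 v2 w \<longleftrightarrow>
     p \<in> P \<and> inv_div_at I (LM lt ` P) (LM lt p) v1 v2 w"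

text \<open>
  \<open>inv_remainder I lt P f r\<close>: some run of the reduction of \<open>f\<close> by \<open>P\<close> ends with remainder \<open>r\<close>.
  The choice of divisor and factorisation in a step is left open; when \<open>I\<close> is strong and
  \<open>P\<close> is autoreduced there is at most one choice.
\<close>

inductive inv_remainder ::
  "'x involutive_division \<Rightarrow> 'x mon_order \<Rightarrow> ('x, 'k::field) ncpoly set \<Rightarrow>
   ('x, 'k) ncpoly \<Rightarrow> ('x, 'k) ncpoly \<Rightarrow> bool"
  for I :: "'x involutive_division" and lt :: "'x mon_order" and P :: "('x, 'k) ncpoly set"
where
  finish: "inv_remainder I lt P 0 0"
| reduce: "\<lbrakk> f \<noteq> 0; poly_inv_div_at I lt P p v1 v2 (LM lt f);
     inv_remainder I lt P
       (f - Poly_Mapping.single v1 (LC lt f * inverse (LC lt p)) * p * Poly_Mapping.single v2 1) r \<rbrakk>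
     \<Longrightarrow> inv_remainder I lt P f r"
| move: "\<lbrakk> f \<noteq> 0; \<nexists>p v1 v2. poly_inv_div_at I lt P p v1 v2 (LM lt f);
     inv_remainder I lt P (f - LT lt f) r \<rbrakk>
     \<Longrightarrow> inv_remainder I lt P f (LT lt f + r)"

definition reduces_to_zero ::
  "'x involutive_division \<Rightarrow> 'x mon_order \<Rightarrow> ('x, 'k::field) ncpoly set \<Rightarrow>
   ('x, 'k) ncpoly \<Rightarrow> bool" where
  "reduces_to_zero I lt P f \<longleftrightarrow> inv_remainder I lt P f 0"

definition autoreduced ::
  "'x involutive_division \<Rightarrow> 'x mon_order \<Rightarrow> ('x, 'k::zero) ncpoly set \<Rightarrow> bool" where
  "autoreduced I lt P \<longleftrightarrow>
     (\<forall>p\<in>P. \<forall>p'\<in>P - {p}. \<forall>m\<in>Poly_Mapping.keys p. \<not> inv_divides I (LM lt ` P) (LM lt p') m)"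

definition locally_involutive_basis ::
  "'x involutive_division \<Rightarrow> 'x mon_order \<Rightarrow> ('x, 'k::field) ncpoly set \<Rightarrow> bool" where
  "locally_involutive_basis I lt P \<longleftrightarrow>
     autoreduced I lt P \<and>
     (\<forall>p\<in>P. \<forall>x. x \<notin> left_mult I (LM lt ` P) (LM lt p) \<longrightarrow>
        reduces_to_zero I lt P (var x * p)) \<and>
     (\<forall>p\<in>P. \<forall>x. x \<notin> right_mult I (LM lt ` P) (LM lt p) \<longrightarrow>
        reduces_to_zero I lt P (p * var x))"

definition involutive_basis ::
  "'x involutive_division \<Rightarrow> 'x mon_order \<Rightarrow> ('x, 'k::field) ncpoly set \<Rightarrow> bool" where
  "involutive_basis I lt P \<longleftrightarrow>
     autoreduced I lt P \<and>
     (\<forall>p\<in>P. \<forall>u v. is_term u \<longrightarrow> is_term v \<longrightarrow> reduces_to_zero I lt P (u * p * v))"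

end

theory Submission
  imports Defs "HOL-Library.Infinite_Set"
begin

text \<open>
  The polynomials that involutively reduce to zero are the combinations of involutive multiples of
  elements of \<open>P\<close>: since cones are disjoint and divisors unique, distinct multiples have distinct
  leading monomials. So it suffices to write every \<open>l p r\<close> as such a combination, which is done by
  induction on the leading monomial \<open>w = l u r\<close>. If \<open>l p r\<close> is not an involutive multiple, a
  neighbouring letter of the occurrence of \<open>u\<close> in \<open>w\<close> is nonmultiplicative, and the reduction of
  the prolongation by that letter replaces \<open>l p r\<close>, modulo smaller multiples, by a multiple for
  another occurrence in \<open>w\<close>. Continuity says that these replacements do not cycle, except that it
  ignores steps whose divisor divides the prolongations on both sides. Such a step goes from
  \<open>x\<^sup>k\<close> to \<open>x\<^sup>k\<^sup>+\<^sup>1\<close> and can be preceded only by steps of the same kind, so it lies on no cycle.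
\<close>

section \<open>Admissible orderings and leading terms\<close>

lemma admissible_trans: "admissible lt \<Longrightarrow> lt a b \<Longrightarrow> lt b c \<Longrightarrow> lt a c"
  unfolding admissible_def by (meson transpD)

lemma admissible_irrefl: "admissible lt \<Longrightarrow> \<not> lt a a"
  unfolding admissible_def by (meson irreflpD)

lemma admissible_total: "admissible lt \<Longrightarrow> a \<noteq> b \<Longrightarrow> lt a b \<or> lt b a"
  unfolding admissible_def totalp_on_def by blast

lemma admissible_Nil: "admissible lt \<Longrightarrow> m \<noteq> [] \<Longrightarrow> lt [] m"
  unfolding admissible_def by blast

lemma admissible_mult: "admissible lt \<Longrightarrow> lt a b \<Longrightarrow> lt (l @ a @ r) (l @ b @ r)"
  unfolding admissible_def by blast

text \<open>By totality, failure means \<open>a = b\<close> or \<open>lt b a\<close>; prepending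
  \<open>x\<close> then contradicts irreflexivity.\<close>

lemma admissible_Cons_cancel:
  assumes "admissible lt" "lt (x # a) (x # b)"
  shows "lt a b"
  using assms admissible_total[of lt a b] admissible_mult[of lt b a "[x]" "[]"]
    admissible_trans[of lt "x # a" "x # b" "x # a"] admissible_irrefl[of lt "x # a"]
  by auto

lemma admissible_tl:
  assumes "admissible lt" "w \<noteq> []"
  shows "lt (tl w) w"
  using assms admissible_mult[OF assms(1) admissible_Nil[OF assms(1), of "[hd w]"], of "[]" "tl w"]
  by simp

text \<open>
  A minimal bad sequence argument: infinitely many words of a descending chain that is minimal in
  length begin with the same letter, and by cancellation their tails again form a descending chain.
\<close>

lemma wfp_admissible:
  fixes lt :: "'x::finite mon_order"
  assumes adm: "admissible lt"
  shows "wfp lt"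
proof -
  define bad where "bad w \<longleftrightarrow> (\<exists>f. f (0::nat) = w \<and> (\<forall>i. lt (f (Suc i)) (f i)))" for w
  have bad_next: "\<exists>v. bad v \<and> lt v w" if w: "bad w" for w
  proof -
    obtain f where "f 0 = w" "\<And>i. lt (f (Suc i)) (f i)" using w unfolding bad_def by blast
    then show ?thesis unfolding bad_def
      by (intro exI[of _ "f 1"] conjI exI[of _ "\<lambda>i. f (Suc i)"]) auto
  qed
  have bad_nonempty: "w \<noteq> []" if "bad w" for w
    using bad_next[OF that] admissible_Nil[OF adm] admissible_irrefl[OF adm]
      admissible_trans[OF adm] by metis
  have no_bad: "\<not> bad w" for w
  proof
    assume w: "bad w"
    \<comment> \<open>The chain starts with a shortest bad word, and each next term is a shortest
      bad word below its predecessor. The candidate sets are nonempty by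
      \<open>bad_next\<close>.\<close>
    define g where "g = rec_nat (arg_min length bad) (\<lambda>_ w. arg_min length (\<lambda>v. bad v \<and> lt v w))"
    have g0: "bad (g 0)" "\<And>v. bad v \<Longrightarrow> length (g 0) \<le> length v"
      using arg_min_nat_lemma[of bad w length] w by (auto simp: g_def)
    have gS: "(bad (g (Suc n)) \<and> lt (g (Suc n)) (g n)) \<and>
        (\<forall>v. bad v \<and> lt v (g n) \<longrightarrow> length (g (Suc n)) \<le> length v)" if gn: "bad (g n)" for n
    proof -
      obtain v where "bad v \<and> lt v (g n)" using bad_next[OF gn] by blast
      then show ?thesis
        using arg_min_nat_lemma[of "\<lambda>v. bad v \<and> lt v (g n)" v length] by (simp add: g_def)
    qed
    have bad_g: "bad (g n)" for n by (induction n) (use g0 gS in auto)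
    have g_desc: "lt (g j) (g i)" if "i < j" for i j
      using that gS[OF bad_g] by (induction rule: less_Suc_induct) (auto intro: admissible_trans[OF adm])
    have g_min: "length (g n) \<le> length v" if v: "bad v" "lt v (g n)" for v n
    proof (cases n)
      case 0
      then show ?thesis using g0 v by simp
    next
      case (Suc k)
      \<comment> \<open>A word below \<open>g (Suc k)\<close> is also below \<open>g k\<close>, so
        it already competed when \<open>g (Suc k)\<close> was chosen.\<close>
      then have "lt v (g k)" using v(2) gS[OF bad_g[of k]] admissible_trans[OF adm] by blast
      then show ?thesis using Suc v(1) gS[OF bad_g[of k]] by blast
    qed
    obtain n where "infinite {m. hd (g m) = hd (g n)}"
      using pigeonhole_infinite[of "UNIV :: nat set" "\<lambda>m. hd (g m)"] by auto
    then obtain N where N: "infinite N" "\<And>m. m \<in> N \<Longrightarrow> hd (g m) = hd (g n)" by auto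
    define e where "e = enumerate N"
    define h where "h k = tl (g (e k))" for k
    have h: "g (e k) = hd (g n) # h k" for k
      using N(2)[of "e k"] enumerate_in_set[OF N(1)] bad_nonempty[OF bad_g]
      by (metis e_def h_def list.collapse)
    have "lt (h (Suc k)) (h k)" for k
    proof -
      have "lt (g (e (Suc k))) (g (e k))"
        unfolding e_def by (intro g_desc enumerate_step N(1))
      then show ?thesis by (metis h admissible_Cons_cancel[OF adm])
    qed
    \<comment> \<open>The word \<open>h 0\<close> is bad and below \<open>g (e 0)\<close>, yet one
      letter shorter, against minimality.\<close>
    then have "bad (h 0)" unfolding bad_def by (intro exI[of _ h]) simp
    moreover have "lt (h 0) (g (e 0))"
      using admissible_tl[OF adm bad_nonempty[OF bad_g]] by (simp add: h_def)
    ultimately show False using g_min[of "h 0" "e 0"] h[of 0] by simp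
  qed
  then show ?thesis
    unfolding wfp_def wf_iff_no_infinite_down_chain bad_def by auto
qed

text \<open>The bound is put on all monomials rather than on \<open>LM\<close>, so that it covers
  the zero polynomial, whose \<open>LM\<close> has no meaning.\<close>

definition below :: "'x mon_order \<Rightarrow> 'x list \<Rightarrow> ('x, 'k::zero) ncpoly \<Rightarrow> bool" where
  "below lt w f \<longleftrightarrow> (\<forall>m\<in>Poly_Mapping.keys f. lt m w)"

lemma below_zero: "below lt w 0"
  by (simp add: below_def)

lemma below_single: "lt m w \<Longrightarrow> below lt w (Poly_Mapping.single m c)"
  by (simp add: below_def)

lemma below_add: "below lt w f \<Longrightarrow> below lt w g \<Longrightarrow> below lt w (f + g)"
  using Poly_Mapping.keys_add[of f g] by (auto simp: below_def)

lemma below_diff: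
  fixes f g :: "('x, 'k::ab_group_add) ncpoly"
  shows "below lt w f \<Longrightarrow> below lt w g \<Longrightarrow> below lt w (f - g)"
  unfolding below_def by (auto simp: in_keys_iff lookup_minus)

lemma below_trans: "admissible lt \<Longrightarrow> below lt v f \<Longrightarrow> lt v w \<Longrightarrow> below lt w f"
  by (auto simp: below_def intro: admissible_trans)

lemma LM_eqI:
  assumes "admissible lt" "m \<in> Poly_Mapping.keys f"
    "\<And>m'. m' \<in> Poly_Mapping.keys f \<Longrightarrow> m' \<noteq> m \<Longrightarrow> lt m' m"
  shows "LM lt f = m"
  unfolding LM_def
proof (rule the_equality)
  fix n assume n: "n \<in> Poly_Mapping.keys f \<and> (\<forall>m'\<in>Poly_Mapping.keys f. m' \<noteq> n \<longrightarrow> lt m' n)"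
  show "n = m"
  proof (rule ccontr)
    assume "n \<noteq> m"
    then have "lt n m" "lt m n" using n assms(2,3) by auto
    then show False using admissible_trans admissible_irrefl assms(1) by metis
  qed
qed (use assms in auto)

lemma leading_add:
  fixes f :: "('x, 'k::ab_group_add) ncpoly"
  assumes "admissible lt" "c \<noteq> 0" "below lt w f"
  shows "LM lt (Poly_Mapping.single w c + f) = w" "LC lt (Poly_Mapping.single w c + f) = c"
    "w \<in> Poly_Mapping.keys (Poly_Mapping.single w c + f)"
proof -
  have *: "Poly_Mapping.lookup (Poly_Mapping.single w c + f) w = c"
    using assms admissible_irrefl[of lt w] by (auto simp: lookup_add below_def in_keys_iff)
  then show w: "w \<in> Poly_Mapping.keys (Poly_Mapping.single w c + f)"
    using assms(2) by (simp add: in_keys_iff)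
  show "LM lt (Poly_Mapping.single w c + f) = w"
    using assms Poly_Mapping.keys_add[of "Poly_Mapping.single w c" f]
    by (intro LM_eqI w) (auto simp: below_def split: if_splits)
  then show "LC lt (Poly_Mapping.single w c + f) = c"
    using * by (simp add: LC_def)
qed

lemma leading_in_keys:
  assumes adm: "admissible lt" and "f \<noteq> 0"
  shows "LM lt f \<in> Poly_Mapping.keys f"
    and "\<And>m. m \<in> Poly_Mapping.keys f \<Longrightarrow> m \<noteq> LM lt f \<Longrightarrow> lt m (LM lt f)"
proof -
  have "\<exists>m\<in>S. \<forall>m'\<in>S. m' \<noteq> m \<longrightarrow> lt m' m" if "finite S" "S \<noteq> {}" for S
    using that
  proof (induction rule: finite_ne_induct)
    case (insert x F)
    then obtain m where m: "m \<in> F" "\<forall>m'\<in>F. m' \<noteq> m \<longrightarrow> lt m' m" by blast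
    show ?case
    proof (cases "lt x m")
      case True
      then show ?thesis using m by auto
    next
      case False
      then have "lt m x" using admissible_total[OF adm] m(1) insert.hyps by metis
      then show ?thesis using m admissible_trans[OF adm] by (metis insert_iff)
    qed
  qed simp
  from this[of "Poly_Mapping.keys f"] obtain m where
    m: "m \<in> Poly_Mapping.keys f" "\<forall>m'\<in>Poly_Mapping.keys f. m' \<noteq> m \<longrightarrow> lt m' m"
    using assms(2) by auto
  then have "LM lt f = m" using LM_eqI[OF adm] by metis
  then show "LM lt f \<in> Poly_Mapping.keys f"
    "\<And>m. m \<in> Poly_Mapping.keys f \<Longrightarrow> m \<noteq> LM lt f \<Longrightarrow> lt m (LM lt f)"
    using m by auto
qed

lemma LC_nonzero: "admissible lt \<Longrightarrow> f \<noteq> 0 \<Longrightarrow> LC lt f \<noteq> 0"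
  using leading_in_keys(1)[of lt f] by (simp add: LC_def in_keys_iff)

lemma below_tail:
  fixes f :: "('x, 'k::ab_group_add) ncpoly"
  assumes "admissible lt" "f \<noteq> 0"
  shows "below lt (LM lt f) (f - LT lt f)"
  unfolding below_def LT_def
proof
  fix m assume m: "m \<in> Poly_Mapping.keys (f - Poly_Mapping.single (LM lt f) (LC lt f))"
  then have "m \<noteq> LM lt f" by (auto simp: in_keys_iff lookup_minus LC_def)
  moreover from this m have "m \<in> Poly_Mapping.keys f"
    by (simp add: in_keys_iff lookup_minus lookup_single)
  ultimately show "lt m (LM lt f)" using leading_in_keys(2)[OF assms] by blast
qed

section \<open>Two-sided multiples of polynomials and their leading terms\<close>

text \<open>This has exactly the shape of the multiple subtracted in \<open>reduce\<close>: the
  scalar sits in the left factor only.\<close>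

definition sandwich ::
  "'k \<Rightarrow> 'x list \<Rightarrow> ('x, 'k) ncpoly \<Rightarrow> 'x list \<Rightarrow> ('x, 'k::field) ncpoly" where
  "sandwich c l p r = Poly_Mapping.single l c * p * Poly_Mapping.single r 1"

lemma sandwich_zero: "sandwich 0 l p r = 0"
  by (simp add: sandwich_def)

lemma sandwich_add_coeff: "sandwich (c + d) l p r = sandwich c l p r + sandwich d l p r"
  by (simp add: sandwich_def single_add algebra_simps)

lemma sandwich_add: "sandwich c l (p + q) r = sandwich c l p r + sandwich c l q r"
  by (simp add: sandwich_def algebra_simps)

lemma sandwich_sandwich:
  fixes p :: "('x, 'k::field) ncpoly"
  shows "sandwich d l' (sandwich c l p r) r' = sandwich (d * c) (l' @ l) p (r @ r')"
proof -
  have "Poly_Mapping.single l' d * Poly_Mapping.single l c = Poly_Mapping.single (l' @ l) (d * c)"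
    "Poly_Mapping.single r (1::'k) * Poly_Mapping.single r' 1 = Poly_Mapping.single (r @ r') 1"
    by (simp_all add: mult_single plus_list_def)
  then show ?thesis unfolding sandwich_def by (metis mult.assoc)
qed

lemma sandwich_single:
  "sandwich c l (Poly_Mapping.single m d) r = Poly_Mapping.single (l @ m @ r) (c * d)"
  by (simp add: sandwich_def mult_single plus_list_def)

lemma below_sandwich:
  fixes f :: "('x, 'k::field) ncpoly"
  assumes "admissible lt" "below lt w f"
  shows "below lt (l @ w @ r) (sandwich c l f r)"
  unfolding below_def
proof
  fix m assume "m \<in> Poly_Mapping.keys (sandwich c l f r)"
  then obtain m1 m2 where "m1 \<in> Poly_Mapping.keys (Poly_Mapping.single l c * f)"
    "m2 \<in> Poly_Mapping.keys (Poly_Mapping.single r (1::'k))" "m = m1 + m2"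
    using keys_mult unfolding sandwich_def by blast
  moreover from this(1) obtain m3 m4 where "m3 \<in> Poly_Mapping.keys (Poly_Mapping.single l c)"
    "m4 \<in> Poly_Mapping.keys f" "m1 = m3 + m4"
    using keys_mult by blast
  ultimately have "m = l @ m4 @ r" "m4 \<in> Poly_Mapping.keys f"
    by (auto simp: plus_list_def split: if_splits)
  then show "lt m (l @ w @ r)"
    using assms by (auto simp: below_def intro: admissible_mult)
qed

text \<open>Admissibility makes two-sided multiplication by words strictly monotone, so the tail of
  \<open>p\<close> stays below the new leading monomial.\<close>

lemma sandwich_split:
  assumes "admissible lt" "p \<noteq> 0"
  obtains g where "below lt (l @ LM lt p @ r) g"
    "sandwich c l p r = Poly_Mapping.single (l @ LM lt p @ r) (c * LC lt p) + g"
proof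
  show "below lt (l @ LM lt p @ r) (sandwich c l (p - LT lt p) r)"
    using below_sandwich[OF assms(1) below_tail[OF assms]] .
  show "sandwich c l p r = Poly_Mapping.single (l @ LM lt p @ r) (c * LC lt p)
      + sandwich c l (p - LT lt p) r"
    using sandwich_add[of c l "LT lt p" "p - LT lt p" r] by (simp add: sandwich_single LT_def)
qed

lemma leading_sandwich_add:
  assumes "admissible lt" "p \<noteq> 0" "c \<noteq> 0" "below lt (l @ LM lt p @ r) f"
  shows "LM lt (sandwich c l p r + f) = l @ LM lt p @ r"
    "LC lt (sandwich c l p r + f) = c * LC lt p"
    "l @ LM lt p @ r \<in> Poly_Mapping.keys (sandwich c l p r + f)"
proof -
  let ?w = "l @ LM lt p @ r"
  obtain g where g: "below lt ?w g" "sandwich c l p r = Poly_Mapping.single ?w (c * LC lt p) + g"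
    using sandwich_split[OF assms(1,2)] .
  have "c * LC lt p \<noteq> 0" using LC_nonzero[OF assms(1,2)] assms(3) by simp
  from leading_add[OF assms(1) this below_add[OF g(1) assms(4)]]
  show "LM lt (sandwich c l p r + f) = ?w" "LC lt (sandwich c l p r + f) = c * LC lt p"
    "?w \<in> Poly_Mapping.keys (sandwich c l p r + f)"
    unfolding g(2) by (simp_all only: add.assoc)
qed

text \<open>The coefficient is chosen so that the two leading terms cancel, leaving a difference of
  two tails.\<close>

lemma below_reduct:
  assumes "admissible lt" "f \<noteq> 0" "p \<noteq> 0" "LM lt f = l @ LM lt p @ r"
  shows "below lt (LM lt f) (f - sandwich (LC lt f * inverse (LC lt p)) l p r)"
proof -
  let ?c = "LC lt f * inverse (LC lt p)"
  obtain g where g: "below lt (LM lt f) g"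
    "sandwich ?c l p r = Poly_Mapping.single (LM lt f) (?c * LC lt p) + g"
    using sandwich_split[OF assms(1,3)] unfolding assms(4) .
  have "?c * LC lt p = LC lt f" using LC_nonzero[OF assms(1,3)] by simp
  then have "f - sandwich ?c l p r = (f - LT lt f) - g" by (simp only: g(2) LT_def diff_diff_eq)
  then show ?thesis using below_diff[OF below_tail[OF assms(1,2)] g(1)] by (simp only:)
qed

section \<open>Occurrences of divisors in a word\<close>

lemma eq_append_surroundD:
  assumes "u = a @ u @ b"
  shows "a = []" "b = []"
  using arg_cong[OF assms, of length] by (simp_all del: append_assoc)

text \<open>Only the letters of the context that touch \<open>u\<close> are tested. Deleting the
  outermost letter keeps the touching one or empties the context.\<close>

lemma inv_div_at_drop_left:
  assumes "inv_div_at I U u v1 v2 (x # w)" "v1 \<noteq> []"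
  shows "inv_div_at I U u (tl v1) v2 w"
proof -
  obtain v where v: "v1 = x # v" using assms by (cases v1) (auto simp: inv_div_at_def)
  show ?thesis using assms(1) unfolding v inv_div_at_def by (simp split: if_splits)
qed

lemma inv_div_at_drop_right:
  assumes "inv_div_at I U u v1 v2 (w @ [x])" "v2 \<noteq> []"
  shows "inv_div_at I U u v1 (butlast v2) w"
proof -
  obtain v where v: "v2 = v @ [x]"
    using assms by (cases v2 rule: rev_cases) (auto simp: inv_div_at_def simp flip: append_assoc)
  show ?thesis
    using assms(1) unfolding v inv_div_at_def by (simp add: hd_append flip: append_assoc split: if_splits)
qed

lemma inv_divides_refl: "inv_divides I U u u"
proof -
  have "inv_div_at I U u [] [] u" by (simp add: inv_div_at_def)
  then show ?thesis unfolding inv_divides_def by blast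
qed

lemma strong_unique_divisor:
  assumes "strong I" "finite U" "u \<in> U"
    "inv_div_at I U u v1 v2 w" "inv_div_at I U u v1' v2' w"
  shows "v1 = v1' \<and> v2 = v2'"
proof -
  have "w \<in> cone I U u" using assms(4) by (auto simp: cone_def inv_divides_def)
  then have "\<exists>!v. case v of (v1, v2) \<Rightarrow> inv_div_at I U u v1 v2 w"
    using assms(1)[unfolded strong_def, THEN spec, THEN mp, OF assms(2), THEN conjunct2,
        THEN conjunct1] assms(3) by simp
  then have "(v1, v2) = (v1', v2')"
    using assms(4,5) by (metis (mono_tags, lifting) case_prod_conv)
  then show ?thesis by simp
qed

text \<open>The part of \<open>autoreduced\<close> that concerns leading monomials alone; the
  combinatorics of occurrences uses nothing else about the polynomials.\<close>

definition inv_autoreduced :: "'x involutive_division \<Rightarrow> 'x list set \<Rightarrow> bool" where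
  "inv_autoreduced I U \<longleftrightarrow> (\<forall>u\<in>U. \<forall>u'\<in>U. inv_divides I U u' u \<longrightarrow> u' = u)"

text \<open>Each word lies in its own cone, so nested cones make one of the two words divide the
  other, which autoreduction forbids for distinct words.\<close>

lemma strong_cones_disjoint:
  assumes "strong I" "finite U" "inv_autoreduced I U" "u1 \<in> U" "u2 \<in> U"
    "inv_divides I U u1 w" "inv_divides I U u2 w"
  shows "u1 = u2"
proof -
  have self: "u \<in> cone I U u" for u by (simp add: cone_def inv_divides_refl)
  have "w \<in> cone I U u1 \<inter> cone I U u2" using assms by (simp add: cone_def)
  then have "cone I U u1 \<subseteq> cone I U u2 \<or> cone I U u2 \<subseteq> cone I U u1"
    using assms(1)[unfolded strong_def, THEN spec, THEN mp, OF assms(2), THEN conjunct1]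
      assms(4,5) by auto
  then have "inv_divides I U u2 u1 \<or> inv_divides I U u1 u2"
    using self[of u1] self[of u2] by (auto simp: cone_def)
  then show ?thesis using assms(3-5) unfolding inv_autoreduced_def by metis
qed

text \<open>In an autoreduced set the divisor of a prolongation must contain the new letter.\<close>

lemma left_divisor_prefix:
  assumes "inv_autoreduced I U" "u \<in> U" "u' \<in> U" "x \<notin> left_mult I U u"
    "inv_div_at I U u' v1 v2 (x # u)"
  shows "v1 = []"
proof (rule ccontr)
  assume v1: "v1 \<noteq> []"
  have "inv_div_at I U u' (tl v1) v2 u" using inv_div_at_drop_left[OF assms(5) v1] .
  moreover from this have "u' = u"
    using assms(1-3) unfolding inv_autoreduced_def inv_divides_def by blast
  \<comment> \<open>Comparing lengths leaves only the new letter in \<open>v1\<close>; that letter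
    would have to be left multiplicative for \<open>u\<close>.\<close>
  ultimately have "u = tl v1 @ u @ v2" by (simp add: inv_div_at_def)
  then have "tl v1 = []" by (rule eq_append_surroundD)
  then obtain y where y: "v1 = [y]" using v1 by (cases v1) auto
  have "x # u = v1 @ u' @ v2" using assms(5) by (simp add: inv_div_at_def)
  then have "last v1 = x" unfolding y by simp
  then show False using assms(4,5) v1 \<open>u' = u\<close> by (simp add: inv_div_at_def)
qed

lemma right_divisor_suffix:
  assumes "inv_autoreduced I U" "u \<in> U" "u' \<in> U" "x \<notin> right_mult I U u"
    "inv_div_at I U u' v1 v2 (u @ [x])"
  shows "v2 = []"
proof (rule ccontr)
  assume v2: "v2 \<noteq> []"
  have "inv_div_at I U u' v1 (butlast v2) u" using inv_div_at_drop_right[OF assms(5) v2] .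
  moreover from this have "u' = u"
    using assms(1-3) unfolding inv_autoreduced_def inv_divides_def by blast
  ultimately have "u = v1 @ u @ butlast v2" by (simp add: inv_div_at_def)
  then have "butlast v2 = []" by (rule eq_append_surroundD)
  then obtain y where y: "v2 = [y]" using v2 by (cases v2 rule: rev_cases) auto
  have "u @ [x] = (v1 @ u') @ v2" using assms(5) by (simp add: inv_div_at_def)
  then have "hd v2 = x" unfolding y append1_eq_conv by simp
  then show False using assms(4,5) v2 \<open>u' = u\<close> by (simp add: inv_div_at_def)
qed

section \<open>Moves between occurrences of divisors in a fixed word\<close>

type_synonym 'x occurrence = "'x list \<times> 'x list \<times> 'x list"

definition occurrences :: "'x list set \<Rightarrow> 'x list \<Rightarrow> 'x occurrence set" where
  "occurrences U w = {(l, u, r). u \<in> U \<and> w = l @ u @ r}"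

text \<open>
  The chains of the continuity condition use a prolongation only if its involutive divisor does not
  also divide the prolongation on the other side. A divisor of both prolongations gives rise to the
  steps of \<open>double_steps\<close>, about which continuity says nothing.
\<close>

definition chain_steps :: "'x involutive_division \<Rightarrow> 'x list set \<Rightarrow> 'x list \<Rightarrow> 'x occurrence rel" where
  "chain_steps I U w = {((l, u, r), (l', u', r')).
     (l, u, r) \<in> occurrences U w \<and> (l', u', r') \<in> occurrences U w \<and>
     chain_step I U l u r l' u' r'}"

definition double_steps :: "'x involutive_division \<Rightarrow> 'x list set \<Rightarrow> 'x list \<Rightarrow> 'x occurrence rel" where
  "double_steps I U w = {((l, u, r), (l', u', r')).
     (l, u, r) \<in> occurrences U w \<and> (l', u', r') \<in> occurrences U w \<and>
     left_cond I U l u u' \<and> right_cond I U u r u'}"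

lemma finite_occurrences: "finite (occurrences U w)"
proof (rule finite_subset)
  let ?S = "{v. set v \<subseteq> set w \<and> length v \<le> length w}"
  show "occurrences U w \<subseteq> ?S \<times> ?S \<times> ?S" by (auto simp: occurrences_def)
  show "finite (?S \<times> ?S \<times> ?S)" by (intro finite_cartesian_product finite_lists_length_le finite_set)
qed

text \<open>A word has finitely many occurrences, so acyclicity suffices, and a cycle would be a
  chain that returns to its first pair of contexts. The converse is taken because the induction
  passes from the targets of steps back to their sources.\<close>

lemma wf_chain_steps:
  assumes "continuous_division I" "finite U"
  shows "wf ((chain_steps I U w)\<inverse>)"
proof (rule finite_acyclic_wf_converse)
  show "finite (chain_steps I U w)"
    by (rule finite_subset[of _ "occurrences U w \<times> occurrences U w"])
      (auto simp: chain_steps_def finite_occurrences)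
  show "acyclic (chain_steps I U w)"
  proof (rule acyclicI, intro allI notI)
    fix s assume "(s, s) \<in> (chain_steps I U w)\<^sup>+"
    then obtain n where n: "n > 0" "(s, s) \<in> chain_steps I U w ^^ n" by (auto simp: trancl_power)
    then obtain f where f: "f 0 = s" "f n = s" "\<And>i. i < n \<Longrightarrow> (f i, f (Suc i)) \<in> chain_steps I U w"
      unfolding relpow_fun_conv by blast
    \<comment> \<open>The sequences of the continuity condition are indexed from 1, whereas
      \<open>f\<close> starts at 0.\<close>
    define l u r where "l i = fst (f (i - 1))" and "u i = fst (snd (f (i - 1)))"
      and "r i = snd (snd (f (i - 1)))" for i
    have fi: "f i = (l (Suc i), u (Suc i), r (Suc i))" for i
      by (simp add: l_def u_def r_def)
    have step: "chain_step I U (l i) (u i) (r i) (l (Suc i)) (u (Suc i)) (r (Suc i))"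
      "(l i, u i, r i) \<in> occurrences U w" "(l (Suc i), u (Suc i), r (Suc i)) \<in> occurrences U w"
      if "1 \<le> i \<and> i < Suc n" for i
    proof -
      have "f (i - 1) = (l i, u i, r i)" using fi[of "i - 1"] that by simp
      then have "((l i, u i, r i), (l (Suc i), u (Suc i), r (Suc i))) \<in> chain_steps I U w"
        using f(3)[of "i - 1"] fi[of i] that by auto
      then show "chain_step I U (l i) (u i) (r i) (l (Suc i)) (u (Suc i)) (r (Suc i))"
        "(l i, u i, r i) \<in> occurrences U w" "(l (Suc i), u (Suc i), r (Suc i)) \<in> occurrences U w"
        unfolding chain_steps_def by blast+
    qed
    \<comment> \<open>The last entry has no outgoing step, so it is known as an occurrence only as
      the target of step \<open>n\<close>.\<close>
    have "(l i, u i, r i) \<in> occurrences U w" if "i \<in> {1..Suc n}" for i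
      using step(2)[of i] step(3)[of n] that n(1) by (cases "i = Suc n") auto
    then have occ: "\<forall>i\<in>{1..Suc n}. u i \<in> U \<and> w = l i @ u i @ r i"
      unfolding occurrences_def by blast
    have inj: "inj_on (\<lambda>i. (l i, r i)) {1..Suc n}"
      using assms(1)[unfolded continuous_division_def, rule_format, of U "Suc n" u w l r]
        assms(2) occ step(1) by simp
    have "(l 1, r 1) = (l (Suc n), r (Suc n))"
      using f(1,2) by (simp add: l_def r_def)
    then have "1 = Suc n" by (rule inj_onD[OF inj]) simp_all
    then show False using n(1) by simp
  qed
qed

text \<open>By autoreduction \<open>u'\<close> is a prefix of \<open>x u\<close> and a suffix of
  \<open>u y\<close>, where \<open>x\<close> and \<open>y\<close> are the neighbouring letters. Were
  it a proper one, it would divide \<open>x u y\<close> at two factorisations, against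
  uniqueness.\<close>

lemma double_step_longer:
  assumes "strong I" "finite U" "inv_autoreduced I U" "u \<in> U" "u' \<in> U"
    "left_cond I U l u u'" "right_cond I U u r u'"
  shows "u' = last l # u" "u' = u @ [hd r]"
proof -
  let ?x = "last l" and ?y = "hd r"
  obtain a v2 v1 b where d: "inv_div_at I U u' a v2 (?x # u)" "inv_div_at I U u' v1 b (u @ [?y])"
    using assms(6,7) by (auto simp: left_cond_def right_cond_def inv_divides_def)
  have "a = []" "b = []"
    using left_divisor_prefix[OF assms(3-5) _ d(1)] right_divisor_suffix[OF assms(3-5) _ d(2)]
      assms(6,7) by (auto simp: left_cond_def right_cond_def)
  note d = d[unfolded this]
  have eqs: "?x # u = u' @ v2" "u @ [?y] = v1 @ u'" using d by (auto simp: inv_div_at_def)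
  have len: "length v1 = length v2" using arg_cong[OF eqs(1), of length] arg_cong[OF eqs(2), of length] by simp
  have "v2 = []"
  proof (rule ccontr)
    assume v2: "v2 \<noteq> []"
    then have "v1 \<noteq> []" using len by auto
    have "?x # u @ [?y] = u' @ v2 @ [?y]" using arg_cong[OF eqs(1), of "\<lambda>v. v @ [?y]"] by simp
    then have "inv_div_at I U u' [] (v2 @ [?y]) (?x # u @ [?y])"
      using d(1) v2 by (simp add: inv_div_at_def)
    moreover have "inv_div_at I U u' (?x # v1) [] (?x # u @ [?y])"
      using d(2) eqs(2) \<open>v1 \<noteq> []\<close> by (simp add: inv_div_at_def)
    ultimately show False using strong_unique_divisor[OF assms(1,2,5)] by blast
  qed
  then show "u' = ?x # u" "u' = u @ [?y]" using eqs len by auto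
qed

text \<open>Every double step lengthens the divisor by one letter, and the length of
  \<open>w\<close> is a bound.\<close>

lemma wf_double_steps:
  assumes "strong I" "finite U" "inv_autoreduced I U"
  shows "wf ((double_steps I U w)\<inverse>)"
proof (rule wf_subset[OF wf_measure])
  have "length w - length u' < length w - length u"
    if "((l, u, r), (l', u', r')) \<in> double_steps I U w" for l u r l' u' r'
  proof -
    have "u' = last l # u" "w = l' @ u' @ r'"
      using that double_step_longer(1)[OF assms, of u u' l r]
      unfolding double_steps_def occurrences_def by blast+
    then show ?thesis by simp
  qed
  then show "(double_steps I U w)\<inverse> \<subseteq> measure (\<lambda>(l, u, r). length w - length u)"
    by auto
qed

text \<open>
  In a double step from \<open>u\<close> we have \<open>x u = u y\<close>, so \<open>u\<close> is a power of \<open>x = y\<close>; a step into \<open>u\<close> can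
  then only come from the next smaller power, which is again divided on both sides.
\<close>

lemma chain_step_not_into_double:
  assumes "strong I" "finite U" "inv_autoreduced I U" "u0 \<in> U" "u \<in> U" "u' \<in> U"
    and step: "chain_step I U l0 u0 r0 l u r"
    and double: "left_cond I U l u u'" "right_cond I U u r u'"
  shows False
proof -
  have power: "last l # u = u @ [hd r]"
    using double_step_longer[OF assms(1-3,5,6) double] by (rule trans[OF sym])
  let ?z = "last l0" and ?z' = "hd r0"
  have ends: "last l \<notin> left_mult I U u" "hd r \<notin> right_mult I U u" "l \<noteq> []" "r \<noteq> []"
    using double by (auto simp: left_cond_def right_cond_def)
  from step consider
    (left) v1 v2 where "left_cond I U l0 u0 u" "\<not> right_cond I U u0 r0 u"
      "inv_div_at I U u v1 v2 (?z # u0)" "l = butlast l0 @ v1" "r = v2 @ r0"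
    | (right) v1 v2 where "right_cond I U u0 r0 u" "\<not> left_cond I U l0 u0 u"
      "inv_div_at I U u v1 v2 (u0 @ [?z'])" "l = l0 @ v1" "r = v2 @ tl r0"
    unfolding chain_step_def left_place_def right_place_def by blast
  then show False
  proof cases
    case left
    have "v1 = []"
      using left_divisor_prefix[OF assms(3,4,5) _ left(3)] left(1) by (auto simp: left_cond_def)
    \<comment> \<open>Otherwise the first letter of \<open>r\<close> is that of \<open>v2\<close>,
      hence right multiplicative for \<open>u\<close>, contrary to the double step out of
      \<open>u\<close>.\<close>
    moreover have "v2 = []" using left(3,5) ends(2) by (auto simp: inv_div_at_def hd_append split: if_splits)
    ultimately have u: "u = ?z # u0" and r: "r = r0" using left(3,5) by (auto simp: inv_div_at_def)
    \<comment> \<open>Both sides of \<open>power\<close> now start with a letter that can be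
      removed, leaving \<open>u\<close> on the left and \<open>u0 @ [hd r0]\<close> on the
      right.\<close>
    have "u = u0 @ [hd r0]" using power unfolding r u by simp
    moreover have "hd r0 \<notin> right_mult I U u0"
    proof
      assume "hd r0 \<in> right_mult I U u0"
      then have "inv_div_at I U u0 [] [hd r0] u" using \<open>u = u0 @ [hd r0]\<close> by (simp add: inv_div_at_def)
      then have "u0 = u" using assms(3-5) by (auto simp: inv_autoreduced_def inv_divides_def)
      then show False using u by simp
    qed
    \<comment> \<open>So \<open>u\<close> divides the prolongations of \<open>u0\<close> on both
      sides, which \<open>chain_step\<close> excludes.\<close>
    ultimately have "right_cond I U u0 r0 u"
      using ends r by (auto simp: right_cond_def inv_divides_def inv_div_at_def intro!: exI[of _ "[]"])
    then show False using left by blast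
  next
    case right
    have "v2 = []"
      using right_divisor_suffix[OF assms(3,4,5) _ right(3)] right(1) by (auto simp: right_cond_def)
    moreover have "v1 = []" using right(3,4) ends(1) by (auto simp: inv_div_at_def last_append split: if_splits)
    ultimately have u: "u = u0 @ [?z']" and l: "l = l0" using right(3,4) by (auto simp: inv_div_at_def)
    have "(last l0 # u0) @ [?z'] = (u0 @ [?z']) @ [hd r]" using power unfolding l u by simp
    then have "u = last l0 # u0" unfolding u append1_eq_conv by simp
    moreover have "last l0 \<notin> left_mult I U u0"
    proof
      assume "last l0 \<in> left_mult I U u0"
      then have "inv_div_at I U u0 [last l0] [] u" using \<open>u = last l0 # u0\<close> by (simp add: inv_div_at_def)
      then have "u0 = u" using assms(3-5) by (auto simp: inv_autoreduced_def inv_divides_def)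
      then show False using u by simp
    qed
    ultimately have "left_cond I U l0 u0 u"
      using ends l by (auto simp: left_cond_def inv_divides_def inv_div_at_def intro!: exI[of _ "[]"])
    then show False using right by blast
  qed
qed

text \<open>No chain step is followed by a double step, so the composition of the converses is empty
  and \<open>wf_union_compatible\<close> applies.\<close>

lemma wf_prolongation_steps:
  assumes "strong I" "continuous_division I" "finite U" "inv_autoreduced I U"
  shows "wf ((chain_steps I U w \<union> double_steps I U w)\<inverse>)"
proof -
  have "(double_steps I U w)\<inverse> O (chain_steps I U w)\<inverse> = {}"
  proof -
    have False if "(s0, s) \<in> chain_steps I U w" "(s, s') \<in> double_steps I U w" for s0 s s'
    proof -
      obtain l0 u0 r0 l u r l' u' r' where "s0 = (l0, u0, r0)" "s = (l, u, r)" "s' = (l', u', r')"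
        using prod_cases3 by metis
      then show False
        using that chain_step_not_into_double[OF assms(1,3,4), of u0 u u' l0 r0 l r]
        by (simp add: chain_steps_def double_steps_def occurrences_def)
    qed
    then show ?thesis by blast
  qed
  then have "wf ((double_steps I U w)\<inverse> \<union> (chain_steps I U w)\<inverse>)"
    using wf_double_steps[OF assms(1,3,4)] wf_chain_steps[OF assms(2,3)]
    by (intro wf_union_compatible) auto
  then show ?thesis by (simp add: converse_Un Un_commute)
qed

section \<open>Reduction to zero\<close>

text \<open>Scalars are central although the algebra is not commutative; this lets the coefficients
  of both outer terms be collected on the left.\<close>

lemma single_Nil_commute:
  fixes p :: "('x, 'k::field) ncpoly"
  shows "p * Poly_Mapping.single [] c = Poly_Mapping.single [] c * p"
proof (induction p rule: update_induct)
  case const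
  then show ?case by simp
next
  case (update p m d)
  have "Poly_Mapping.update m d p = p + Poly_Mapping.single m d"
    using update(1) by (intro poly_mapping_eqI)
      (auto simp: lookup_update lookup_add lookup_single in_keys_iff when_def)
  then show ?case
    using update(3) by (simp add: distrib_left distrib_right mult_single plus_list_def mult.commute)
qed

lemma term_mult_eq_sandwich:
  fixes p :: "('x, 'k::field) ncpoly"
  shows "Poly_Mapping.single l c * p * Poly_Mapping.single r d = sandwich (d * c) l p r"
proof -
  have d: "Poly_Mapping.single r d = Poly_Mapping.single [] d * Poly_Mapping.single r 1"
    "Poly_Mapping.single [] d * Poly_Mapping.single l c = Poly_Mapping.single l (d * c)"
    by (simp_all add: mult_single plus_list_def)
  have "Poly_Mapping.single l c * p * Poly_Mapping.single r d
      = Poly_Mapping.single l c * p * Poly_Mapping.single [] d * Poly_Mapping.single r 1"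
    by (subst d(1)) (simp only: mult.assoc)
  also have "\<dots> = Poly_Mapping.single [] d * Poly_Mapping.single l c * p * Poly_Mapping.single r 1"
    by (simp only: single_Nil_commute flip: mult.assoc)
  also have "\<dots> = sandwich (d * c) l p r" by (simp only: d sandwich_def)
  finally show ?thesis .
qed

lemma var_mult_eq_sandwich:
  fixes p :: "('x, 'k::field) ncpoly"
  shows "var x * p = sandwich 1 [x] p []" "p * var x = sandwich 1 [] p [x]"
proof -
  have "(Poly_Mapping.single [] 1 :: ('x, 'k) ncpoly) = 1" by (simp flip: zero_list_def)
  then show "var x * p = sandwich 1 [x] p []" "p * var x = sandwich 1 [] p [x]"
    by (simp_all add: var_def sandwich_def)
qed

text \<open>
  Combinations of involutive multiples of elements of \<open>P\<close>, built by adding strictly larger leading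
  monomials. These are the polynomials that involutively reduce to zero.
\<close>

inductive inv_span ::
  "'x involutive_division \<Rightarrow> 'x mon_order \<Rightarrow> ('x, 'k::field) ncpoly set \<Rightarrow>
   ('x, 'k) ncpoly \<Rightarrow> bool"
  for I lt P
where
  zero: "inv_span I lt P 0"
| add: "\<lbrakk> poly_inv_div_at I lt P p l r (l @ LM lt p @ r); c \<noteq> 0;
     below lt (l @ LM lt p @ r) f; inv_span I lt P f \<rbrakk>
     \<Longrightarrow> inv_span I lt P (sandwich c l p r + f)"

text \<open>A reduction step leaves a polynomial below the current leading monomial, and a moved
  term has that monomial itself, so upper bounds pass to the remainder.\<close>

lemma inv_remainder_below:
  assumes "admissible lt" "0 \<notin> P" "inv_remainder I lt P f r" "below lt w f"
  shows "below lt w r"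
  using assms(3,4)
proof (induction arbitrary: w rule: inv_remainder.induct)
  case (reduce f p v1 v2 r)
  have "p \<noteq> 0" "LM lt f = v1 @ LM lt p @ v2"
    using reduce(2) assms(2) by (auto simp: poly_inv_div_at_def inv_div_at_def)
  then have "below lt (LM lt f) (f - sandwich (LC lt f * inverse (LC lt p)) v1 p v2)"
    using below_reduct[OF assms(1) reduce(1)] by blast
  moreover have "lt (LM lt f) w"
    using reduce.prems leading_in_keys(1)[OF assms(1) reduce(1)] by (simp add: below_def)
  ultimately show ?case
    using reduce.IH below_trans[OF assms(1)] unfolding sandwich_def by blast
next
  case (move f r)
  have w: "lt (LM lt f) w"
    using move.prems leading_in_keys(1)[OF assms(1) move(1)] by (simp add: below_def)
  then have "below lt w r"
    using move.IH below_trans[OF assms(1) below_tail[OF assms(1) move(1)]] by blast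
  then show ?case using w unfolding LT_def by (intro below_add below_single)
qed

text \<open>A moved leading monomial is never cancelled later, since the rest of the run stays below it.\<close>

lemma reduces_to_zero_step:
  assumes "admissible lt" "0 \<notin> P" "inv_remainder I lt P f 0" "f \<noteq> 0"
  obtains p v1 v2 where "poly_inv_div_at I lt P p v1 v2 (LM lt f)"
    "inv_remainder I lt P (f - sandwich (LC lt f * inverse (LC lt p)) v1 p v2) 0"
  using assms(3)
proof cases
  case finish
  then show ?thesis using assms(4) by simp
next
  case (reduce p v1 v2)
  then show ?thesis using that unfolding sandwich_def by blast
next
  case (move r)
  have "below lt (LM lt f) r"
    using inv_remainder_below[OF assms(1,2) move(4) below_tail[OF assms(1,4)]] .
  then have "LM lt f \<in> Poly_Mapping.keys (LT lt f + r)"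
    using leading_add(3)[OF assms(1) LC_nonzero[OF assms(1,4)]] by (simp add: LT_def)
  then show ?thesis using move(1) by (metis empty_iff keys_zero)
qed

lemma inv_span_if_reduces_to_zero:
  assumes "admissible lt" "0 \<notin> P" "inv_remainder I lt P f 0"
  shows "inv_span I lt P f"
proof -
  \<comment> \<open>The remainder is kept as a variable with an equation so that rule induction
    applies.\<close>
  have "inv_span I lt P f" if "inv_remainder I lt P f r" "r = 0" for f r
    using that
  proof (induction rule: inv_remainder.induct)
    case finish
    show ?case by (rule inv_span.zero)
  next
    case (reduce f p v1 v2 r)
    let ?c = "LC lt f * inverse (LC lt p)"
    have p: "p \<noteq> 0" "LM lt f = v1 @ LM lt p @ v2"
      using reduce(2) assms(2) by (auto simp: poly_inv_div_at_def inv_div_at_def)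
    have "?c \<noteq> 0" using LC_nonzero[OF assms(1) reduce(1)] LC_nonzero[OF assms(1) p(1)] by simp
    moreover have "inv_span I lt P (f - sandwich ?c v1 p v2)"
      using reduce by (simp add: sandwich_def)
    ultimately have "inv_span I lt P (sandwich ?c v1 p v2 + (f - sandwich ?c v1 p v2))"
      using reduce(2) below_reduct[OF assms(1) reduce(1) p] unfolding p(2)
      by (intro inv_span.add)
    then show ?case by simp
  next
    case (move f r)
    \<comment> \<open>The remainder contains the moved term uncancelled, so it cannot be zero and
      this case is void.\<close>
    have "below lt (LM lt f) r"
      using inv_remainder_below[OF assms(1,2) move(3) below_tail[OF assms(1) move(1)]] .
    then have "LM lt f \<in> Poly_Mapping.keys (LT lt f + r)"
      using leading_add(3)[OF assms(1) LC_nonzero[OF assms(1) move(1)]] by (simp add: LT_def)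
    then show ?case using move.prems by simp
  qed
  then show ?thesis using assms(3) by blast
qed

text \<open>The summand added last carries the leading term, so one reduction step can remove
  exactly that summand.\<close>

lemma inv_remainder_zero_if_inv_span:
  assumes "admissible lt" "0 \<notin> P" "inv_span I lt P f"
  shows "inv_remainder I lt P f 0"
  using assms(3)
proof induction
  case zero
  show ?case by (rule inv_remainder.finish)
next
  case (add p l r c f)
  let ?f = "sandwich c l p r + f"
  have p: "p \<noteq> 0" using add(1) assms(2) by (auto simp: poly_inv_div_at_def)
  note lead = leading_sandwich_add[OF assms(1) p add(2,3)]
  have "LC lt ?f * inverse (LC lt p) = c"
    using lead(2) LC_nonzero[OF assms(1) p] by simp
  then have "?f - Poly_Mapping.single l (LC lt ?f * inverse (LC lt p)) * p * Poly_Mapping.single r 1 = f"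
    by (simp add: sandwich_def)
  moreover have "?f \<noteq> 0" using lead(3) by auto
  ultimately show ?case
    using add(1,5) lead(1) by (intro inv_remainder.reduce[of ?f I lt P p l r]) auto
qed

lemma inj_on_LM_autoreduced:
  assumes "admissible lt" "0 \<notin> P" "autoreduced I lt P"
  shows "inj_on (LM lt) P"
proof (rule inj_onI, rule ccontr)
  fix p q assume pq: "p \<in> P" "q \<in> P" "LM lt p = LM lt q" "p \<noteq> q"
  have "LM lt p \<in> Poly_Mapping.keys p"
    using leading_in_keys(1)[OF assms(1)] pq(1) assms(2) by metis
  moreover have "inv_divides I (LM lt ` P) (LM lt q) (LM lt p)"
    unfolding pq(3) by (rule inv_divides_refl)
  ultimately show False using assms(3) pq unfolding autoreduced_def by blast
qed

lemma inv_autoreduced_LM: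
  assumes "admissible lt" "0 \<notin> P" "autoreduced I lt P"
  shows "inv_autoreduced I (LM lt ` P)"
  unfolding inv_autoreduced_def
proof (intro ballI impI, elim imageE, rule ccontr)
  fix u u' p p'
  assume *: "inv_divides I (LM lt ` P) u' u" "u' \<noteq> u" "u = LM lt p" "p \<in> P" "u' = LM lt p'" "p' \<in> P"
  have "p' \<in> P - {p}" using * by auto
  moreover have "LM lt p \<in> Poly_Mapping.keys p"
    using leading_in_keys(1)[OF assms(1)] *(4) assms(2) by metis
  ultimately show False using * assms(3) unfolding autoreduced_def by blast
qed

section \<open>Closure of the span of involutive multiples under addition and two-sided
  multiplication\<close>

locale strong_autoreduced =
  fixes I :: "'x::finite involutive_division"
    and lt :: "'x mon_order"
    and P :: "('x, 'k::field) ncpoly set"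
  assumes strong: "strong I"
    and admissible: "admissible lt"
    and finite: "finite P"
    and zero_notin: "0 \<notin> P"
    and autoreduced: "autoreduced I lt P"
begin

lemma poly_inv_div_at_unique:
  assumes "poly_inv_div_at I lt P p l r w" "poly_inv_div_at I lt P p' l' r' w"
  shows "p = p'" "l = l'" "r = r'"
proof -
  have P: "p \<in> P" "p' \<in> P" "inv_div_at I (LM lt ` P) (LM lt p) l r w"
    "inv_div_at I (LM lt ` P) (LM lt p') l' r' w"
    using assms by (auto simp: poly_inv_div_at_def)
  have fin: "finite (LM lt ` P)" using finite by simp
  have LM: "LM lt p = LM lt p'"
    using P by (intro strong_cones_disjoint[OF strong fin
          inv_autoreduced_LM[OF admissible zero_notin autoreduced], of _ _ w])
      (auto simp: inv_divides_def)
  then show "p = p'"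
    using P inj_on_LM_autoreduced[OF admissible zero_notin autoreduced] by (simp add: inj_onD)
  show "l = l'" "r = r'"
    using strong_unique_divisor[OF strong fin _ P(3) P(4)[folded LM]] P(1) by auto
qed

text \<open>Works like insertion into a sorted list. If the leading monomials agree, unique divisors
  make the two multiples proportional, and their coefficients merge or cancel.\<close>

lemma inv_span_insert:
  assumes "inv_span I lt P f" "poly_inv_div_at I lt P p l r (l @ LM lt p @ r)"
  shows "inv_span I lt P (sandwich c l p r + f)"
  using assms(1)
proof (induction arbitrary: c)
  case zero
  show ?case
  proof (cases "c = 0")
    case False
    then show ?thesis using inv_span.add[OF assms(2) _ below_zero inv_span.zero] by simp
  qed (simp add: sandwich_zero inv_span.zero)
next
  case (add p' l' r' c' f)
  let ?w = "l @ LM lt p @ r" and ?w' = "l' @ LM lt p' @ r'"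
  have nz: "p \<noteq> 0" "p' \<noteq> 0" using assms(2) add(1) zero_notin by (auto simp: poly_inv_div_at_def)
  have below': "below lt v (sandwich d l p r)" if "lt ?w v" for v d
  proof -
    obtain g where "below lt ?w g" "sandwich d l p r = Poly_Mapping.single ?w (d * LC lt p) + g"
      using sandwich_split[OF admissible nz(1)] .
    then show ?thesis
      using below_trans[OF admissible _ that] that by (auto intro: below_add below_single)
  qed
  consider "c = 0" | "c \<noteq> 0" "lt ?w' ?w" | "lt ?w ?w'" | "?w = ?w'"
    using admissible_total[OF admissible] by blast
  then show ?case
  proof cases
    case 1
    then show ?thesis using inv_span.add[OF add(1-4)] by (simp add: sandwich_zero)
  next
    case 2
    obtain g where g: "below lt ?w' g"
      "sandwich c' l' p' r' = Poly_Mapping.single ?w' (c' * LC lt p') + g"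
      using sandwich_split[OF admissible nz(2)] .
    have "below lt ?w (sandwich c' l' p' r' + f)"
      unfolding g(2) using 2 g(1) add(3) below_trans[OF admissible]
      by (blast intro: below_add below_single)
    then show ?thesis using inv_span.add[OF assms(2) 2(1) _ inv_span.add[OF add(1-4)]] by blast
  next
    case 3
    have "inv_span I lt P (sandwich c' l' p' r' + (sandwich c l p r + f))"
      by (rule inv_span.add[OF add(1,2) below_add[OF below'[OF 3] add(3)] add(5)])
    then show ?thesis by (simp add: algebra_simps)
  next
    case 4
    then have eq: "p = p'" "l = l'" "r = r'"
      using poly_inv_div_at_unique[OF assms(2) add(1)[folded 4]] by auto
    have sum: "sandwich c l p r + (sandwich c' l' p' r' + f) = sandwich (c + c') l p r + f"
      by (simp add: eq sandwich_add_coeff add.assoc)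
    show ?thesis
    proof (cases "c + c' = 0")
      case True
      then show ?thesis using add(4) unfolding sum by (simp add: sandwich_zero)
    next
      case False
      then show ?thesis
        unfolding sum by (rule inv_span.add[OF assms(2) _ add(3)[folded 4] add(4)])
    qed
  qed
qed

lemma inv_span_add:
  assumes "inv_span I lt P f" "inv_span I lt P g"
  shows "inv_span I lt P (f + g)"
  using assms(1)
  by induction (simp_all add: assms(2) add.assoc inv_span_insert)

text \<open>Multiplying a summand by words may destroy its involutivity. The third assumption, later
  supplied by induction on the leading monomial, repairs each summand separately.\<close>

lemma inv_span_sandwich:
  assumes "inv_span I lt P g" "below lt w g"
    and "\<And>c p l r. p \<in> P \<Longrightarrow> lt (l @ LM lt p @ r) w \<Longrightarrow> inv_span I lt P (sandwich c (l' @ l) p (r @ r'))"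
  shows "inv_span I lt P (sandwich d l' g r')"
  using assms(1,2)
proof induction
  case zero
  then show ?case by (simp add: sandwich_def inv_span.zero)
next
  case (add p l r c f)
  have p: "p \<in> P" "p \<noteq> 0" using add(1) zero_notin by (auto simp: poly_inv_div_at_def)
  have w: "lt (l @ LM lt p @ r) w"
    using add.prems leading_sandwich_add(3)[OF admissible p(2) add(2,3)] by (simp add: below_def)
  have "inv_span I lt P (sandwich d l' f r')"
    using add.IH below_trans[OF admissible add(3) w] .
  then show ?case
    using inv_span_add[OF assms(3)[OF p(1) w, of "d * c"]]
    by (simp add: sandwich_add sandwich_sandwich)
qed

lemma inv_span_multiple:
  assumes cont: "continuous_division I"
    and left: "\<And>p x. p \<in> P \<Longrightarrow> x \<notin> left_mult I (LM lt ` P) (LM lt p) \<Longrightarrow>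
      reduces_to_zero I lt P (var x * p)"
    and right: "\<And>p x. p \<in> P \<Longrightarrow> x \<notin> right_mult I (LM lt ` P) (LM lt p) \<Longrightarrow>
      reduces_to_zero I lt P (p * var x)"
    and "p \<in> P"
  shows "inv_span I lt P (sandwich c l p r)"
proof -
  let ?U = "LM lt ` P"
  have U: "finite ?U" "inv_autoreduced I ?U"
    using finite inv_autoreduced_LM[OF admissible zero_notin autoreduced] by auto
  have "\<forall>c l p r. p \<in> P \<longrightarrow> w = l @ LM lt p @ r \<longrightarrow> inv_span I lt P (sandwich c l p r)" for w
  \<comment> \<open>The outer induction is on the word, the inner one on occurrences in that fixed
    word along prolongation steps.\<close>
  proof (induction w rule: wfp_induct[OF wfp_admissible[OF admissible]])
    case (1 w)
    have smaller: "inv_span I lt P (sandwich c l p r)" if "p \<in> P" "lt (l @ LM lt p @ r) w" for c l p r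
      using 1 that by blast
    let ?R = "(chain_steps I ?U w \<union> double_steps I ?U w)\<inverse>"
    have "\<forall>c l p r. p \<in> P \<longrightarrow> s = (l, LM lt p, r) \<longrightarrow> w = l @ LM lt p @ r \<longrightarrow>
      inv_span I lt P (sandwich c l p r)" for s
    proof (induction s rule: wf_induct[OF wf_prolongation_steps[OF strong cont U, of w]])
      case (1 s)
      show ?case
      proof (intro allI impI)
        fix c l p r
        assume p: "p \<in> P" and s: "s = (l, LM lt p, r)" and w: "w = l @ LM lt p @ r"
        have p0: "p \<noteq> 0" using p zero_notin by auto
        \<comment> \<open>Treats both sides at once: one of \<open>a\<close>, \<open>b\<close> will
          be a single nonmultiplicative letter and the other empty, while \<open>l'\<close> and
          \<open>r'\<close> are what remains of the context.\<close>
        have prolong: "inv_span I lt P (sandwich c l p r)"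
          if red: "reduces_to_zero I lt P (sandwich 1 a p b)"
            and l: "l = l' @ a" and r: "r = b @ r'"
            and step: "\<And>p' v1 v2. poly_inv_div_at I lt P p' v1 v2 (a @ LM lt p @ b) \<Longrightarrow>
              ((l' @ v1, LM lt p', v2 @ r'), (l, LM lt p, r)) \<in> ?R"
          for a b l' r'
        proof -
          let ?f = "sandwich 1 a p b" and ?m = "a @ LM lt p @ b"
          have lead: "LM lt ?f = ?m" "?f \<noteq> 0"
            using leading_sandwich_add(1,3)[OF admissible p0 one_neq_zero below_zero, of a b] by auto
          obtain p' v1 v2 where p': "poly_inv_div_at I lt P p' v1 v2 ?m"
            "inv_remainder I lt P (?f - sandwich (LC lt ?f * inverse (LC lt p')) v1 p' v2) 0"
            using reduces_to_zero_step[OF admissible zero_notin red[unfolded reduces_to_zero_def] lead(2)]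
            unfolding lead(1) by blast
          define d where "d = LC lt ?f * inverse (LC lt p')"
          define g where "g = ?f - sandwich d v1 p' v2"
          have p'_props: "p' \<in> P" "p' \<noteq> 0" "?m = v1 @ LM lt p' @ v2"
            using p'(1) zero_notin by (auto simp: poly_inv_div_at_def inv_div_at_def)
          have g_below: "below lt ?m g"
            using below_reduct[OF admissible lead(2) p'_props(2)] p'_props(3) lead(1)
            by (simp add: g_def d_def)
          have g_span: "inv_span I lt P g"
            using inv_span_if_reduces_to_zero[OF admissible zero_notin p'(2)] by (simp add: g_def d_def)
          \<comment> \<open>The summands of \<open>g\<close> lie below the prolongation, so in
            context they lie below \<open>w\<close> and the outer induction covers them.\<close>
          have "inv_span I lt P (sandwich c l' g r')"
          proof (rule inv_span_sandwich[OF g_span g_below])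
            fix e q k t assume q: "q \<in> P" "lt (k @ LM lt q @ t) ?m"
            have "lt (l' @ (k @ LM lt q @ t) @ r') (l' @ ?m @ r')"
              by (rule admissible_mult[OF admissible q(2)])
            then show "inv_span I lt P (sandwich e (l' @ k) q (t @ r'))"
              using q(1) w l r by (intro smaller) simp_all
          qed
          \<comment> \<open>The leading summand of the reduction keeps the word \<open>w\<close> but
            sits at the occurrence reached by the step, so the inner induction applies.\<close>
          moreover have "inv_span I lt P (sandwich (c * d) (l' @ v1) p' (v2 @ r'))"
          proof -
            have "w = (l' @ v1) @ LM lt p' @ (v2 @ r')"
              using w l r p'_props(3) by (metis append.assoc)
            then show ?thesis using 1 step[OF p'(1)] p'_props(1) s by blast
          qed
          moreover have "sandwich c l p r
            = sandwich (c * d) (l' @ v1) p' (v2 @ r') + sandwich c l' g r'"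
          proof -
            have "?f = sandwich d v1 p' v2 + g" by (simp add: g_def)
            then have "sandwich c l' ?f r' = sandwich c l' (sandwich d v1 p' v2) r' + sandwich c l' g r'"
              by (simp add: sandwich_add)
            then show ?thesis by (simp add: sandwich_sandwich l r)
          qed
          ultimately show ?thesis using inv_span_add by simp
        qed
        have occ: "(l, LM lt p, r) \<in> occurrences ?U w" using p w by (auto simp: occurrences_def)
        consider "poly_inv_div_at I lt P p l r w"
          | "l \<noteq> []" "last l \<notin> left_mult I ?U (LM lt p)"
          | "r \<noteq> []" "hd r \<notin> right_mult I ?U (LM lt p)"
          using p w by (auto simp: poly_inv_div_at_def inv_div_at_def)
        then show "inv_span I lt P (sandwich c l p r)"
        proof cases
          case 1
          then show ?thesis using inv_span_insert[OF inv_span.zero] w by simp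
        next
          case 2
          show ?thesis
          proof (rule prolong[of "[last l]" "[]" "butlast l" r])
            show "reduces_to_zero I lt P (sandwich 1 [last l] p [])"
              using left[OF p 2(2)] by (simp add: var_mult_eq_sandwich)
            fix p' v1 v2 assume "poly_inv_div_at I lt P p' v1 v2 ([last l] @ LM lt p @ [])"
            then have p': "p' \<in> P" "inv_div_at I ?U (LM lt p') v1 v2 (last l # LM lt p)"
              by (auto simp: poly_inv_div_at_def)
            then have lc: "left_cond I ?U l (LM lt p) (LM lt p')"
              using 2 by (auto simp: left_cond_def inv_divides_def)
            have lp: "left_place I ?U l (LM lt p) r (butlast l @ v1) (LM lt p') (v2 @ r)"
              using p'(2) by (auto simp: left_place_def)
            have "last l # LM lt p = v1 @ LM lt p' @ v2" using p'(2) by (simp add: inv_div_at_def)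
            moreover have "w = butlast l @ (last l # LM lt p) @ r" using w 2(1) by simp
            ultimately have "(butlast l @ v1, LM lt p', v2 @ r) \<in> occurrences ?U w"
              using p'(1) by (auto simp: occurrences_def)
            \<comment> \<open>It is a double step if \<open>right_cond\<close> holds for
              \<open>p'\<close> as well, and a chain step otherwise.\<close>
            then show "((butlast l @ v1, LM lt p', v2 @ r), l, LM lt p, r) \<in> ?R"
              using lc lp occ
              by (auto simp: chain_steps_def double_steps_def chain_step_def)
          qed (use 2 in auto)
        next
          case 3
          show ?thesis
          proof (rule prolong[of "[]" "[hd r]" l "tl r"])
            show "reduces_to_zero I lt P (sandwich 1 [] p [hd r])"
              using right[OF p 3(2)] by (simp add: var_mult_eq_sandwich)
            fix p' v1 v2 assume "poly_inv_div_at I lt P p' v1 v2 ([] @ LM lt p @ [hd r])"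
            then have p': "p' \<in> P" "inv_div_at I ?U (LM lt p') v1 v2 (LM lt p @ [hd r])"
              by (auto simp: poly_inv_div_at_def)
            then have rc: "right_cond I ?U (LM lt p) r (LM lt p')"
              using 3 by (auto simp: right_cond_def inv_divides_def)
            have rp: "right_place I ?U l (LM lt p) r (l @ v1) (LM lt p') (v2 @ tl r)"
              using p'(2) by (auto simp: right_place_def)
            have "LM lt p @ [hd r] = v1 @ LM lt p' @ v2" using p'(2) by (simp add: inv_div_at_def)
            moreover have "w = l @ (LM lt p @ [hd r]) @ tl r" using w 3(1) by simp
            ultimately have "(l @ v1, LM lt p', v2 @ tl r) \<in> occurrences ?U w"
              using p'(1) by (auto simp: occurrences_def)
            then show "((l @ v1, LM lt p', v2 @ tl r), l, LM lt p, r) \<in> ?R"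
              using rc rp occ
              by (auto simp: chain_steps_def double_steps_def chain_step_def)
          qed (use 3 in auto)
        qed
      qed
    qed
    then show ?case by blast
  qed
  then show ?thesis using assms(4) by blast
qed

end

theorem proposition5p4p3:
  fixes I :: "'x::finite involutive_division"
    and lt :: "'x mon_order"
    and P :: "('x, 'k::field) ncpoly set"
  assumes "strong I"
    and "continuous_division I"
    and "admissible lt"
    and "finite P"
    and "0 \<notin> P"
    and "locally_involutive_basis I lt P"
  shows "involutive_basis I lt P"
proof -
  interpret strong_autoreduced I lt P
    using assms by unfold_locales (auto simp: locally_involutive_basis_def)
  have "inv_remainder I lt P (sandwich c l p r) 0" if "p \<in> P" for c l p r
    using assms that unfolding locally_involutive_basis_def
    by (intro inv_remainder_zero_if_inv_span inv_span_multiple) auto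
  then show ?thesis
    unfolding involutive_basis_def is_term_def reduces_to_zero_def
    using autoreduced by (auto simp: term_mult_eq_sandwich)
qed

end
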